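(* Let $\nu>0$, let $h:\mathbb{R}_+\to[0,\infty)$ be locally bounded with $\mu:=\int_0^\infty h(t)\,\mathrm{d}t<1$ and $h\in L^2(\mathbb{R}_+,\mathrm{d}x)$, and let $u\in L^1(\mathbb{R},\mathrm{d}x)$. Let $\mathfrak L,\mathfrak L',\widetilde{\mathfrak L},\widetilde{\mathfrak L'}$ be the quantities (depending on $\nu,h,u$) defined in the context. Then: (i) If $$\nu\ge\frac{1}{4(1-\mu)}\min\Big\{\frac{\|u^2\|_{L^2(\mathbb{R},\mathrm{d}x)}^2}{\|u\|_{L^2(\mathbb{R},\mathrm{d}x)}^4},\ \frac{\|h\|_{L^2(\mathbb{R}_+,\mathrm{d}x)}^2}{\mu^2}\Big\},$$ then $\mathfrak L'\le\mathfrak L$. (ii) If $$\nu\ge\frac{1}{4(1-\mu)}\max\bigg\{\min\Big\{\frac{\|u^2\|_{L^2(\mathbb{R},\mathrm{d}x)}^2}{\|u\|_{L^2(\mathbb{R},\mathrm{d}x)}^4},\frac{\|h\|_{L^2(\mathbb{R}_+,\mathrm{d}x)}^2}{\mu^2}\Big\},\ \min\Big\{\frac{\|u\|_{L^2(\mathbb{R},\mathrm{d}x)}^2}{\|u\|_{L^1(\mathbb{R},\mathrm{d}x)}^2},\frac{\|h\|_{L^2(\mathbb{R}_+,\mathrm{d}x)}^2}{\mu^2}\Big\}\bigg\},$$ then $\widetilde{\mathfrak L'}\le\widetilde{\mathfrak L}$.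
   Context: All $L^p$ norms of $u$ are over $(\mathbb{R},\mathrm{d}x)$ and the $L^2$ norm of $h$ is over $(\mathbb{R}_+,\mathrm{d}x)$. Definitions: $$\mathfrak L:=\sqrt{2/\pi}\,\Big|1-\frac{\nu}{1-\mu}\|u\|_{L^2}^2\Big|+\frac{\nu}{1-\mu}\|u\|_{L^3}^3+\frac{2\sqrt{2/\pi}\,\nu\mu(2-\mu)}{(1-\mu)^2}\|u\|_{L^2}^2+\frac{\nu\mu}{(1-\mu)^2}\|u\|_{L^2}\|u^2\|_{L^2},$$ $$\begin{aligned}\mathfrak L':={}&\sqrt{2/\pi}\,\bigg(\Big(1-\frac{\nu}{1-\mu}\|u\|_{L^2}^2\Big)^2+\frac{\nu}{(1-\mu)^3}\min\big\{\mu^2\|u^2\|_{L^2}^2,\ \|h\|_{L^2}^2\|u^2\|_{L^1}^2\big\}\bigg)^{1/2}\\&+\frac{\nu}{1-\mu}\|u\|_{L^3}^3+\frac{2\sqrt{2/\pi}\,\nu\mu}{(1-\mu)^2}\|u\|_{L^2}^2+\frac{\nu\mu}{(1-\mu)^2}\|u\|_{L^2}\|u^2\|_{L^2},\end{aligned}$$ $$\widetilde{\mathfrak L}:=\mathfrak L+\frac{2\nu\mu}{1-\mu}\|u\|_{L^1},\qquad \widetilde{\mathfrak L'}:=\mathfrak L'+\frac{\sqrt\nu}{(1-\mu)^{3/2}}\min\big\{\mu\|u\|_{L^2},\ \|h\|_{L^2}\|u\|_{L^1}\big\}.$$ *)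

theory Defs
  imports "HOL-Analysis.Analysis"
begin

(* All norms are extended reals: u is only assumed to be in L^1, so its L^2, L^3 and L^4
   norms may be infinite.  In ereal, 0 * \<infinity> = 0, hence also 0 / 0 = \<infinity> / \<infinity> = 0. *)

(* Intended for x \<ge> 0 and p > 0. *)
definition epowr :: "ereal \<Rightarrow> real \<Rightarrow> ereal" where
  "epowr x p = (if x = \<infinity> then \<infinity> else ereal (real_of_ereal x powr p))"

definition Lp_norm :: "real \<Rightarrow> 'a measure \<Rightarrow> ('a \<Rightarrow> real) \<Rightarrow> ereal" where
  "Lp_norm p M f = epowr (enn2ereal (\<integral>\<^sup>+ x. ennreal (\<bar>f x\<bar> powr p) \<partial>M)) (1 / p)"

definition in_Lp :: "real \<Rightarrow> 'a measure \<Rightarrow> ('a \<Rightarrow> real) \<Rightarrow> bool" where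
  "in_Lp p M f \<longleftrightarrow> f \<in> borel_measurable M \<and> Lp_norm p M f < \<infinity>"

definition locally_bounded_on :: "real set \<Rightarrow> (real \<Rightarrow> real) \<Rightarrow> bool" where
  "locally_bounded_on S f \<longleftrightarrow> (\<forall>t\<in>S. \<exists>e>0. bounded (f ` (S \<inter> ball t e)))"

(* A function on the half-line is a function on the reals whose values at negative
   arguments are irrelevant. *)
abbreviation half_line :: "real measure" where
  "half_line \<equiv> lebesgue_on {0..}"

definition kernel_mass :: "(real \<Rightarrow> real) \<Rightarrow> real" where
  "kernel_mass h = (\<integral>t. h t \<partial>half_line)"

definition frakL :: "real \<Rightarrow> (real \<Rightarrow> real) \<Rightarrow> (real \<Rightarrow> real) \<Rightarrow> ereal" where
  "frakL \<nu> h u =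
    (let \<mu> = kernel_mass h;
         u2 = (\<lambda>x. (u x)\<^sup>2)
     in ereal (sqrt (2 / pi)) * \<bar>1 - ereal (\<nu> / (1 - \<mu>)) * (Lp_norm 2 lebesgue u)\<^sup>2\<bar>
        + ereal (\<nu> / (1 - \<mu>)) * (Lp_norm 3 lebesgue u) ^ 3
        + ereal (2 * sqrt (2 / pi) * \<nu> * \<mu> * (2 - \<mu>) / (1 - \<mu>)\<^sup>2) * (Lp_norm 2 lebesgue u)\<^sup>2
        + ereal (\<nu> * \<mu> / (1 - \<mu>)\<^sup>2) * Lp_norm 2 lebesgue u * Lp_norm 2 lebesgue u2)"

definition frakL' :: "real \<Rightarrow> (real \<Rightarrow> real) \<Rightarrow> (real \<Rightarrow> real) \<Rightarrow> ereal" where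
  "frakL' \<nu> h u =
    (let \<mu> = kernel_mass h;
         u2 = (\<lambda>x. (u x)\<^sup>2)
     in ereal (sqrt (2 / pi)) *
          epowr ((1 - ereal (\<nu> / (1 - \<mu>)) * (Lp_norm 2 lebesgue u)\<^sup>2)\<^sup>2
                 + ereal (\<nu> / (1 - \<mu>) ^ 3) *
                   min (ereal (\<mu>\<^sup>2) * (Lp_norm 2 lebesgue u2)\<^sup>2)
                       ((Lp_norm 2 half_line h)\<^sup>2 * (Lp_norm 1 lebesgue u2)\<^sup>2)) (1 / 2)
        + ereal (\<nu> / (1 - \<mu>)) * (Lp_norm 3 lebesgue u) ^ 3
        + ereal (2 * sqrt (2 / pi) * \<nu> * \<mu> / (1 - \<mu>)\<^sup>2) * (Lp_norm 2 lebesgue u)\<^sup>2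
        + ereal (\<nu> * \<mu> / (1 - \<mu>)\<^sup>2) * Lp_norm 2 lebesgue u * Lp_norm 2 lebesgue u2)"

definition frakL_tilde :: "real \<Rightarrow> (real \<Rightarrow> real) \<Rightarrow> (real \<Rightarrow> real) \<Rightarrow> ereal" where
  "frakL_tilde \<nu> h u =
    (let \<mu> = kernel_mass h
     in frakL \<nu> h u + ereal (2 * \<nu> * \<mu> / (1 - \<mu>)) * Lp_norm 1 lebesgue u)"

definition frakL'_tilde :: "real \<Rightarrow> (real \<Rightarrow> real) \<Rightarrow> (real \<Rightarrow> real) \<Rightarrow> ereal" where
  "frakL'_tilde \<nu> h u =
    (let \<mu> = kernel_mass h
     in frakL' \<nu> h u
        + ereal (sqrt \<nu> / (1 - \<mu>) powr (3 / 2)) *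
          min (ereal \<mu> * Lp_norm 2 lebesgue u)
              (Lp_norm 2 half_line h * Lp_norm 1 lebesgue u))"

end

theory Submission
  imports Defs
begin

text \<open>
  The functionals \<^const>\<open>frakL'\<close> and \<^const>\<open>frakL\<close> share the terms in $\|u\|_3^3$
  and $\|u\|_2\|u^2\|_2$. Subadditivity of the square root, $\sqrt{x^2+K}\le |x|+\sqrt K$ with
  $x = 1-\frac{\nu}{1-\mu}\|u\|_2^2$, splits the square root of \<^const>\<open>frakL'\<close> into the
  modulus of \<^const>\<open>frakL\<close> and $\sqrt K$. The coefficients of their last terms in $\|u\|_2^2$ differ by
  $2\sqrt{2/\pi}\,\nu\mu/(1-\mu)$, because $(2-\mu)-1=1-\mu$, so there is room for $\sqrt K$
  as soon as
  $$\min\{\mu^2\|u^2\|_2^2,\ \|h\|_2^2\|u\|_2^4\}\le 4\nu(1-\mu)\,\mu^2\|u\|_2^4,$$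
  and this is the hypothesis on $\nu$ multiplied by $\mu^2\|u\|_2^4$. The additional term of
  the tilded functionals is compared in the same way: the second hypothesis multiplied by
  $\mu^2\|u\|_1^2$ bounds the square of the minimum. Both multiplications are instances of
  \<open>min_le_cross_multiply\<close>; the two resulting comparisons are \<open>sqrt_term_le\<close> and
  \<open>tilde_term_le\<close>.

  Infinite norms do no harm. If $\|u\|_2=\infty$, then the modulus in \<^const>\<open>frakL\<close>, and
  with it the right-hand side, is infinite. If $\|u\|_2<\infty$, then the second entry of each
  minimum is finite, so the minima are real even when $\|u^2\|_2=\infty$.
\<close>

section \<open>Extended-real norms\<close>

lemma epowr_nonneg: "epowr x p \<ge> 0"
  by (simp add: epowr_def)

lemma Lp_norm_nonneg: "Lp_norm p M f \<ge> 0"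
  by (simp add: Lp_norm_def epowr_nonneg)

lemma Lp_norm_1_power2: "Lp_norm 1 M (\<lambda>x. (f x)\<^sup>2) = (Lp_norm 2 M f)\<^sup>2"
proof -
  have "(\<integral>\<^sup>+ x. ennreal (\<bar>(f x)\<^sup>2\<bar> powr 1) \<partial>M) = (\<integral>\<^sup>+ x. ennreal (\<bar>f x\<bar> powr 2) \<partial>M)"
    by (intro nn_integral_cong) simp
  moreover have "epowr y (1 / 1) = (epowr y (1 / 2))\<^sup>2" if "y \<ge> 0" for y
  proof (cases y)
    case (real r)
    then show ?thesis using that by (simp add: epowr_def powr_half_sqrt)
  qed (use that in \<open>auto simp: epowr_def power2_eq_square\<close>)
  ultimately show ?thesis
    by (simp add: Lp_norm_def)
qed

section \<open>Clearing denominators\<close>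

text \<open>
  The conclusion is the hypothesis multiplied by $SQ$. It survives a vanishing denominator,
  whatever value the quotient then has, because one entry of the minimum in the conclusion
  vanishes as well. It survives $P=\infty$ with $Q>0$, because then the hypothesis bounds
  $R/S$.
\<close>

lemma min_le_cross_multiply:
  fixes P :: ereal and Q R S t :: real
  assumes nonneg: "P \<ge> 0" "Q \<ge> 0" "R \<ge> 0" "S \<ge> 0" "t \<ge> 0"
    and le: "min (P / ereal Q) (ereal R / ereal S) \<le> ereal t"
  shows "min (ereal S * P) (ereal (R * Q)) \<le> ereal (t * S * Q)"
proof (cases "Q = 0 \<or> S = 0")
  case True
  then show ?thesis by (auto simp: zero_ereal_def[symmetric] min_le_iff_disj)
next
  case False
  then have pos: "Q > 0" "S > 0" using nonneg by auto
  from le consider "P / ereal Q \<le> ereal t" | "ereal R / ereal S \<le> ereal t"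
    by (auto simp: min_le_iff_disj)
  then show ?thesis
  proof cases
    case 1
    then show ?thesis
      using pos nonneg by (cases P) (auto simp: field_simps min_le_iff_disj)
  next
    case 2
    then have "R \<le> t * S" using pos by (simp add: field_simps)
    then have "R * Q \<le> t * S * Q" using pos by (simp add: mult_right_mono)
    then show ?thesis by (simp add: min_le_iff_disj)
  qed
qed

lemma scaled_le_iff:
  fixes X :: ereal
  assumes "k > 0"
  shows "ereal (1 / k) * X \<le> ereal v \<longleftrightarrow> X \<le> ereal (k * v)"
proof (cases X)
  case (real x)
  have "1 / k * x \<le> v \<longleftrightarrow> x \<le> k * v"
    using assms by (simp add: pos_divide_le_eq mult.commute)
  then show ?thesis by (simp add: real)
qed (use assms in auto)

text \<open>
  With $q=\|u\|_2^2$ and $p=\|u^2\|_2$, respectively $q=\|u\|_1$ and $p=\|u\|_2$, this turns a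
  hypothesis on $\nu$ into a real bound on the minimum that it controls.
\<close>

lemma min_eq_real_le:
  fixes p :: ereal and q H \<mu> t :: real
  assumes "t \<ge> 0" "p \<ge> 0"
    and "min (p\<^sup>2 / ereal (q\<^sup>2)) (ereal (H\<^sup>2) / ereal (\<mu>\<^sup>2)) \<le> ereal t"
  obtains r where "min (ereal (\<mu>\<^sup>2) * p\<^sup>2) (ereal (H\<^sup>2 * q\<^sup>2)) = ereal r"
    "0 \<le> r" "r \<le> t * \<mu>\<^sup>2 * q\<^sup>2"
proof -
  have "min (ereal (\<mu>\<^sup>2) * p\<^sup>2) (ereal (H\<^sup>2 * q\<^sup>2)) \<le> ereal (t * \<mu>\<^sup>2 * q\<^sup>2)"
    using assms by (intro min_le_cross_multiply) auto
  moreover have "min (ereal (\<mu>\<^sup>2) * p\<^sup>2) (ereal (H\<^sup>2 * q\<^sup>2)) \<ge> 0"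
    using assms by simp
  ultimately show thesis
    using that by (cases "min (ereal (\<mu>\<^sup>2) * p\<^sup>2) (ereal (H\<^sup>2 * q\<^sup>2))") auto
qed

section \<open>Comparison of real quantities\<close>

text \<open>
  The untilded comparison for finite $a = \|u\|_2$, with $r$ the value of the minimum and
  $s=\sqrt{2/\pi}$; the bound on $r$ comes from \<open>min_eq_real_le\<close>.
\<close>

lemma sqrt_term_le:
  fixes \<nu> \<mu> a r s :: real
  assumes "\<nu> > 0" "0 \<le> \<mu>" "\<mu> < 1" "s \<ge> 0" "0 \<le> r"
    and r_le: "r \<le> 4 * (1 - \<mu>) * \<nu> * \<mu>\<^sup>2 * a ^ 4"
  shows "s * sqrt ((1 - \<nu> / (1 - \<mu>) * a\<^sup>2)\<^sup>2 + \<nu> / (1 - \<mu>) ^ 3 * r)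
           + 2 * s * \<nu> * \<mu> / (1 - \<mu>)\<^sup>2 * a\<^sup>2
       \<le> s * \<bar>1 - \<nu> / (1 - \<mu>) * a\<^sup>2\<bar> + 2 * s * \<nu> * \<mu> * (2 - \<mu>) / (1 - \<mu>)\<^sup>2 * a\<^sup>2"
proof -
  define d where "d = 1 - \<mu>"
  define x where "x = 1 - \<nu> / d * a\<^sup>2"
  have d: "d > 0" "\<mu> = 1 - d" using assms by (auto simp: d_def)
  have "\<nu> / d ^ 3 * r \<le> \<nu> / d ^ 3 * (4 * d * \<nu> * \<mu>\<^sup>2 * a ^ 4)"
    using r_le \<open>\<nu> > 0\<close> d(1) by (intro mult_left_mono) (auto simp: d_def)
  also have "\<dots> = (2 * \<nu> * \<mu> / d * a\<^sup>2)\<^sup>2"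
    using d(1) by (simp add: field_simps power2_eq_square power3_eq_cube power4_eq_xxxx)
  finally have "sqrt (\<nu> / d ^ 3 * r) \<le> 2 * \<nu> * \<mu> / d * a\<^sup>2"
    using assms d(1) by (intro real_le_lsqrt) auto
  moreover have "sqrt (x\<^sup>2 + \<nu> / d ^ 3 * r) \<le> \<bar>x\<bar> + sqrt (\<nu> / d ^ 3 * r)"
    using sqrt_add_le_add_sqrt[of "x\<^sup>2" "\<nu> / d ^ 3 * r"] assms d(1) by simp
  ultimately have "sqrt (x\<^sup>2 + \<nu> / d ^ 3 * r) \<le> \<bar>x\<bar> + 2 * \<nu> * \<mu> / d * a\<^sup>2"
    by linarith
  then have "s * sqrt (x\<^sup>2 + \<nu> / d ^ 3 * r) \<le> s * (\<bar>x\<bar> + 2 * \<nu> * \<mu> / d * a\<^sup>2)"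
    using \<open>s \<ge> 0\<close> by (rule mult_left_mono)
  moreover have "2 * s * \<nu> * \<mu> / d\<^sup>2 * a\<^sup>2 + s * (2 * \<nu> * \<mu> / d * a\<^sup>2)
      = 2 * s * \<nu> * \<mu> * (2 - \<mu>) / d\<^sup>2 * a\<^sup>2"
    using d(1) unfolding d(2) by (simp add: field_simps power2_eq_square)
  ultimately show ?thesis
    unfolding d_def[symmetric] x_def[symmetric] distrib_left by linarith
qed

text \<open>The comparison of the additional terms, with $p$ the value of the minimum and
  $b = \|u\|_1$.\<close>

lemma tilde_term_le:
  fixes \<nu> \<mu> b p :: real
  assumes "\<nu> > 0" "0 \<le> \<mu>" "\<mu> < 1" "b \<ge> 0"
    and p2_le: "p\<^sup>2 \<le> 4 * (1 - \<mu>) * \<nu> * \<mu>\<^sup>2 * b\<^sup>2"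
  shows "sqrt \<nu> / (1 - \<mu>) powr (3 / 2) * p \<le> 2 * \<nu> * \<mu> / (1 - \<mu>) * b"
proof -
  define d where "d = 1 - \<mu>"
  have d: "d > 0" using assms by (simp add: d_def)
  have powr: "d powr (3 / 2) = d * sqrt d"
    using d powr_add[of d 1 "1 / 2"] by (simp add: powr_half_sqrt)
  have "p\<^sup>2 \<le> (2 * sqrt d * sqrt \<nu> * \<mu> * b)\<^sup>2"
    using p2_le d \<open>\<nu> > 0\<close> by (simp add: power_mult_distrib d_def)
  then have "p \<le> 2 * sqrt d * sqrt \<nu> * \<mu> * b"
    using assms(1,2,4) d by (auto intro: power2_le_imp_le)
  \<comment> \<open>One factor $\sqrt d$ cancels and $\sqrt\nu\cdot\sqrt\nu=\nu$: this is where the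
    constant $4(1-\mu)$ in the hypothesis comes from.\<close>
  then have "sqrt \<nu> / (d * sqrt d) * p \<le> sqrt \<nu> / (d * sqrt d) * (2 * sqrt d * sqrt \<nu> * \<mu> * b)"
    using d \<open>\<nu> > 0\<close> by (intro mult_left_mono) auto
  also have "\<dots> = 2 * \<nu> * \<mu> / d * b"
    using d \<open>\<nu> > 0\<close> by (simp add: field_simps)
  finally show ?thesis
    using powr by (simp add: d_def)
qed

section \<open>Comparison of the functionals\<close>

lemma kernel_mass_nonneg:
  assumes "\<And>t. t \<ge> 0 \<Longrightarrow> h t \<ge> 0"
  shows "kernel_mass h \<ge> 0"
  unfolding kernel_mass_def using assms by (intro Bochner_Integration.integral_nonneg) simp

lemma frakL_eq_infinity:
  assumes "\<nu> > 0" "0 \<le> kernel_mass h" "kernel_mass h < 1" "Lp_norm 2 lebesgue u = \<infinity>"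
  shows "frakL \<nu> h u = \<infinity>"
proof -
  have "ereal (\<nu> / (1 - kernel_mass h)) * (Lp_norm 2 lebesgue u)\<^sup>2 = \<infinity>"
    using assms by (simp add: power2_eq_square)
  moreover have "Lp_norm 3 lebesgue u ^ 3 \<ge> 0"
    by (simp add: Lp_norm_nonneg)
  moreover have "Lp_norm 2 lebesgue (\<lambda>x. (u x)\<^sup>2) \<ge> 0"
    by (rule Lp_norm_nonneg)
  moreover have "\<bar>1 - (\<infinity> :: ereal)\<bar> = \<infinity>"
    by (simp add: one_ereal_def del: ereal_eq_1)
  ultimately show ?thesis
    using assms unfolding frakL_def Let_def by simp
qed

lemma frakL'_le_frakL:
  fixes \<nu> :: real and h u :: "real \<Rightarrow> real"
  assumes nu_pos: "\<nu> > 0"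
    and mass: "0 \<le> kernel_mass h" "kernel_mass h < 1"
    and h_L2: "Lp_norm 2 half_line h < \<infinity>"
    and le: "ereal (1 / (4 * (1 - kernel_mass h))) *
        min ((Lp_norm 2 lebesgue (\<lambda>x. (u x)\<^sup>2))\<^sup>2 / (Lp_norm 2 lebesgue u) ^ 4)
            ((Lp_norm 2 half_line h)\<^sup>2 / (ereal (kernel_mass h))\<^sup>2) \<le> ereal \<nu>"
  shows "frakL' \<nu> h u \<le> frakL \<nu> h u"
proof (cases "Lp_norm 2 lebesgue u = \<infinity>")
  case True
  then show ?thesis
    using frakL_eq_infinity nu_pos mass by simp
next
  case False
  define \<mu> where "\<mu> = kernel_mass h"
  define B where "B = Lp_norm 2 lebesgue (\<lambda>x. (u x)\<^sup>2)"
  define s where "s = sqrt (2 / pi)"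
  note mass = mass[folded \<mu>_def]
  obtain a where a: "Lp_norm 2 lebesgue u = ereal a"
    using False Lp_norm_nonneg[of 2 lebesgue u] by (cases "Lp_norm 2 lebesgue u") auto
  obtain H where H: "Lp_norm 2 half_line h = ereal H"
    using h_L2 Lp_norm_nonneg[of 2 half_line h] by (cases "Lp_norm 2 half_line h") auto
  have a4: "(a\<^sup>2)\<^sup>2 = a ^ 4"
    by simp
  have "min (B\<^sup>2 / ereal ((a\<^sup>2)\<^sup>2)) (ereal (H\<^sup>2) / ereal (\<mu>\<^sup>2)) \<le> ereal (4 * (1 - \<mu>) * \<nu>)"
    using le mass unfolding \<mu>_def[symmetric] B_def[symmetric] a H a4
    by (subst (asm) scaled_le_iff) auto
  moreover have "0 \<le> 4 * (1 - \<mu>) * \<nu>" "B \<ge> 0"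
    using nu_pos mass by (auto simp: B_def Lp_norm_nonneg)
  ultimately obtain r where r: "min (ereal (\<mu>\<^sup>2) * B\<^sup>2) (ereal (H\<^sup>2 * (a\<^sup>2)\<^sup>2)) = ereal r"
    "0 \<le> r" "r \<le> 4 * (1 - \<mu>) * \<nu> * \<mu>\<^sup>2 * (a\<^sup>2)\<^sup>2"
    using min_eq_real_le by metis
  define S where "S = (1 - \<nu> / (1 - \<mu>) * a\<^sup>2)\<^sup>2 + \<nu> / (1 - \<mu>) ^ 3 * r"
  have "S \<ge> 0"
    using nu_pos mass r(2) by (auto simp: S_def)
  then have epowr: "epowr (ereal S) (1 / 2) = ereal (sqrt S)"
    by (simp add: epowr_def powr_half_sqrt)
  have one_minus: "1 - ereal c = ereal (1 - c)" for c
    by (simp add: one_ereal_def del: ereal_eq_1)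
  define T3 where "T3 = ereal (\<nu> / (1 - \<mu>)) * (Lp_norm 3 lebesgue u) ^ 3"
  define T4 where "T4 = ereal (\<nu> * \<mu> / (1 - \<mu>)\<^sup>2) * ereal a * B"
  have "frakL' \<nu> h u
      = ereal (s * sqrt S) + T3 + ereal (2 * s * \<nu> * \<mu> / (1 - \<mu>)\<^sup>2 * a\<^sup>2) + T4"
    using r(1) epowr
    by (simp add: frakL'_def Let_def \<mu>_def[symmetric] Lp_norm_1_power2 B_def[symmetric] a H
        T3_def T4_def S_def s_def one_minus)
  also have "\<dots> = ereal (s * sqrt S + 2 * s * \<nu> * \<mu> / (1 - \<mu>)\<^sup>2 * a\<^sup>2) + (T3 + T4)"
    by (simp add: ac_simps flip: plus_ereal.simps(1))
  also have "\<dots> \<le> ereal (s * \<bar>1 - \<nu> / (1 - \<mu>) * a\<^sup>2\<bar>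
      + 2 * s * \<nu> * \<mu> * (2 - \<mu>) / (1 - \<mu>)\<^sup>2 * a\<^sup>2) + (T3 + T4)"
  proof (intro add_right_mono, unfold ereal_less_eq S_def)
    show "s * sqrt ((1 - \<nu> / (1 - \<mu>) * a\<^sup>2)\<^sup>2 + \<nu> / (1 - \<mu>) ^ 3 * r)
        + 2 * s * \<nu> * \<mu> / (1 - \<mu>)\<^sup>2 * a\<^sup>2
      \<le> s * \<bar>1 - \<nu> / (1 - \<mu>) * a\<^sup>2\<bar> + 2 * s * \<nu> * \<mu> * (2 - \<mu>) / (1 - \<mu>)\<^sup>2 * a\<^sup>2"
      using nu_pos mass r(2,3) by (intro sqrt_term_le) (auto simp: s_def)
  qed
  also have "\<dots> = ereal (s * \<bar>1 - \<nu> / (1 - \<mu>) * a\<^sup>2\<bar>) + T3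
      + ereal (2 * s * \<nu> * \<mu> * (2 - \<mu>) / (1 - \<mu>)\<^sup>2 * a\<^sup>2) + T4"
    by (simp add: ac_simps flip: plus_ereal.simps(1))
  also have "\<dots> = frakL \<nu> h u"
    by (simp add: frakL_def Let_def \<mu>_def[symmetric] B_def[symmetric] a
        T3_def T4_def s_def one_minus)
  finally show ?thesis .
qed

lemma frakL'_tilde_le_frakL_tilde:
  fixes \<nu> :: real and h u :: "real \<Rightarrow> real"
  assumes nu_pos: "\<nu> > 0"
    and mass: "0 \<le> kernel_mass h" "kernel_mass h < 1"
    and h_L2: "Lp_norm 2 half_line h < \<infinity>"
    and u_L1: "Lp_norm 1 lebesgue u < \<infinity>"
    and untilded: "frakL' \<nu> h u \<le> frakL \<nu> h u"
    and le: "ereal (1 / (4 * (1 - kernel_mass h))) *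
        min ((Lp_norm 2 lebesgue u)\<^sup>2 / (Lp_norm 1 lebesgue u)\<^sup>2)
            ((Lp_norm 2 half_line h)\<^sup>2 / (ereal (kernel_mass h))\<^sup>2) \<le> ereal \<nu>"
  shows "frakL'_tilde \<nu> h u \<le> frakL_tilde \<nu> h u"
proof (cases "Lp_norm 2 lebesgue u = \<infinity>")
  case True
  then show ?thesis
    using frakL_eq_infinity[of \<nu> h u] nu_pos mass by (simp add: frakL_tilde_def Let_def)
next
  case False
  define \<mu> where "\<mu> = kernel_mass h"
  note mass = mass[folded \<mu>_def]
  obtain a where a: "Lp_norm 2 lebesgue u = ereal a" "a \<ge> 0"
    using False Lp_norm_nonneg[of 2 lebesgue u] by (cases "Lp_norm 2 lebesgue u") auto
  obtain b where b: "Lp_norm 1 lebesgue u = ereal b" "b \<ge> 0"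
    using u_L1 Lp_norm_nonneg[of 1 lebesgue u] by (cases "Lp_norm 1 lebesgue u") auto
  obtain H where H: "Lp_norm 2 half_line h = ereal H" "H \<ge> 0"
    using h_L2 Lp_norm_nonneg[of 2 half_line h] by (cases "Lp_norm 2 half_line h") auto
  have "min ((ereal a)\<^sup>2 / ereal (b\<^sup>2)) (ereal (H\<^sup>2) / ereal (\<mu>\<^sup>2)) \<le> ereal (4 * (1 - \<mu>) * \<nu>)"
    using le mass unfolding \<mu>_def[symmetric] a b H by (subst (asm) scaled_le_iff) auto
  moreover have "0 \<le> 4 * (1 - \<mu>) * \<nu>" "ereal a \<ge> 0"
    using nu_pos mass a by auto
  ultimately obtain r where r: "min (ereal (\<mu>\<^sup>2) * (ereal a)\<^sup>2) (ereal (H\<^sup>2 * b\<^sup>2)) = ereal r"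
    "r \<le> 4 * (1 - \<mu>) * \<nu> * \<mu>\<^sup>2 * b\<^sup>2"
    using min_eq_real_le by metis
  have "(min (\<mu> * a) (H * b))\<^sup>2 \<le> min (\<mu>\<^sup>2 * a\<^sup>2) (H\<^sup>2 * b\<^sup>2)"
    using mass a b H by (auto simp: power_mult_distrib[symmetric] intro!: power_mono)
  also have "\<dots> = r"
    using r(1) by (auto simp: min_def split: if_splits)
  finally have "sqrt \<nu> / (1 - \<mu>) powr (3 / 2) * min (\<mu> * a) (H * b) \<le> 2 * \<nu> * \<mu> / (1 - \<mu>) * b"
    using nu_pos mass b(2) r(2) by (intro tilde_term_le) auto
  then have "ereal (sqrt \<nu> / (1 - \<mu>) powr (3 / 2)) * min (ereal \<mu> * ereal a) (ereal H * ereal b)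
      \<le> ereal (2 * \<nu> * \<mu> / (1 - \<mu>)) * ereal b"
    by (simp del: ereal_min add: ereal_min[symmetric])
  with untilded show ?thesis
    unfolding frakL'_tilde_def frakL_tilde_def Let_def \<mu>_def[symmetric] a b H
    by (rule add_mono)
qed

theorem proposition5p3:
  fixes \<nu> :: real and h u :: "real \<Rightarrow> real"
  assumes nu_pos: "\<nu> > 0"
    and h_nonneg: "\<And>t. t \<ge> 0 \<Longrightarrow> h t \<ge> 0"
    and h_locally_bounded: "locally_bounded_on {0..} h"
    and h_integrable: "integrable half_line h"
    and mass_less_1: "kernel_mass h < 1"
    and h_L2: "in_Lp 2 half_line h"
    and u_L1: "in_Lp 1 lebesgue u"
  shows
    "(ereal \<nu> \<ge> ereal (1 / (4 * (1 - kernel_mass h))) *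
        min ((Lp_norm 2 lebesgue (\<lambda>x. (u x)\<^sup>2))\<^sup>2 / (Lp_norm 2 lebesgue u) ^ 4)
            ((Lp_norm 2 half_line h)\<^sup>2 / (ereal (kernel_mass h))\<^sup>2)
      \<longrightarrow> frakL' \<nu> h u \<le> frakL \<nu> h u)
    \<and>
     (ereal \<nu> \<ge> ereal (1 / (4 * (1 - kernel_mass h))) *
        max (min ((Lp_norm 2 lebesgue (\<lambda>x. (u x)\<^sup>2))\<^sup>2 / (Lp_norm 2 lebesgue u) ^ 4)
                 ((Lp_norm 2 half_line h)\<^sup>2 / (ereal (kernel_mass h))\<^sup>2))
            (min ((Lp_norm 2 lebesgue u)\<^sup>2 / (Lp_norm 1 lebesgue u)\<^sup>2)
                 ((Lp_norm 2 half_line h)\<^sup>2 / (ereal (kernel_mass h))\<^sup>2))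
      \<longrightarrow> frakL'_tilde \<nu> h u \<le> frakL_tilde \<nu> h u)"
proof -
  have mass: "0 \<le> kernel_mass h"
    using h_nonneg by (rule kernel_mass_nonneg)
  have h_fin: "Lp_norm 2 half_line h < \<infinity>" and u_fin: "Lp_norm 1 lebesgue u < \<infinity>"
    using h_L2 u_L1 by (auto simp: in_Lp_def)
  have k: "4 * (1 - kernel_mass h) > 0"
    using mass_less_1 by simp
  show ?thesis
    unfolding scaled_le_iff[OF k] max.bounded_iff
    using frakL'_le_frakL[OF nu_pos mass mass_less_1 h_fin, of u, unfolded scaled_le_iff[OF k]]
      frakL'_tilde_le_frakL_tilde[OF nu_pos mass mass_less_1 h_fin u_fin,
        unfolded scaled_le_iff[OF k]]
    by blast
qed

end
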